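(* Let $k\ge 3$ be odd and let $G$ be an odd unicycle graph of girth $k$, whose unique cycle has vertices $u_0\sim u_1\sim\dots\sim u_{k-1}\sim u_0$. If the Grover walk on $G$ is periodic, then one of the following holds: (i) $\deg u_0=\deg u_1=\dots=\deg u_{k-1}=2$; (ii) there exists $0\le i\le k-1$ with $\deg u_i=4$ and $\deg u_l=2$ for all $l\neq i$.
   Context: Graphs are simple, connected and finite. An odd unicycle graph is a non-bipartite graph $G$ with $|V(G)|=|E(G)|$, i.e. a connected graph containing exactly one cycle, which has odd length; that length is its girth. For $G=(V,E)$, let $\mathcal{A}=\{(u,v),(v,u)\mid uv\in E\}$; for an arc $e=(u,v)$ write $o(e)=u$, $t(e)=v$, $\bar e=(v,u)$. The Grover walk has time evolution $U$ on $\mathbb{C}^{\mathcal{A}}$ with $U_{e,f}=2/\deg t(f)$ if $t(f)=o(e)$, $e\neq\bar f$; $U_{e,f}=2/\deg t(f)-1$ if $e=\bar f$; $0$ otherwise. The walk is periodic if $U^m=I$ for some positive integer $m$. *)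

theory Defs
  imports Complex_Main
begin

definition simple_graph :: "'a set \<Rightarrow> ('a \<Rightarrow> 'a \<Rightarrow> bool) \<Rightarrow> bool" where
  "simple_graph V E \<longleftrightarrow> finite V \<and> V \<noteq> {} \<and>
     (\<forall>u v. E u v \<longrightarrow> u \<in> V \<and> v \<in> V) \<and>
     (\<forall>u v. E u v \<longrightarrow> E v u) \<and> (\<forall>u. \<not> E u u)"

definition connected_graph :: "'a set \<Rightarrow> ('a \<Rightarrow> 'a \<Rightarrow> bool) \<Rightarrow> bool" where
  "connected_graph V E \<longleftrightarrow> (\<forall>u\<in>V. \<forall>v\<in>V. E\<^sup>*\<^sup>* u v)"

definition bipartite :: "'a set \<Rightarrow> ('a \<Rightarrow> 'a \<Rightarrow> bool) \<Rightarrow> bool" where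
  "bipartite V E \<longleftrightarrow> (\<exists>S. \<forall>u v. E u v \<longrightarrow> (u \<in> S \<longleftrightarrow> v \<notin> S))"

definition edges :: "'a set \<Rightarrow> ('a \<Rightarrow> 'a \<Rightarrow> bool) \<Rightarrow> 'a set set" where
  "edges V E = {{u, v} | u v. u \<in> V \<and> v \<in> V \<and> E u v}"

definition odd_unicycle :: "'a set \<Rightarrow> ('a \<Rightarrow> 'a \<Rightarrow> bool) \<Rightarrow> bool" where
  "odd_unicycle V E \<longleftrightarrow> simple_graph V E \<and> connected_graph V E \<and>
     \<not> bipartite V E \<and> card V = card (edges V E)"

definition deg :: "'a set \<Rightarrow> ('a \<Rightarrow> 'a \<Rightarrow> bool) \<Rightarrow> 'a \<Rightarrow> nat" where
  "deg V E v = card {w \<in> V. E v w}"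

text \<open>Symmetric arcs: (u,v) with uv an edge; o(e) = fst e, t(e) = snd e, reverse = prod.swap.\<close>
definition arcs :: "'a set \<Rightarrow> ('a \<Rightarrow> 'a \<Rightarrow> bool) \<Rightarrow> ('a \<times> 'a) set" where
  "arcs V E = {(u, v). u \<in> V \<and> v \<in> V \<and> E u v}"

definition grover :: "'a set \<Rightarrow> ('a \<Rightarrow> 'a \<Rightarrow> bool) \<Rightarrow> ('a \<times> 'a) \<Rightarrow> ('a \<times> 'a) \<Rightarrow> real" where
  "grover V E e f =
     (if e = prod.swap f then 2 / real (deg V E (snd f)) - 1
      else if snd f = fst e then 2 / real (deg V E (snd f))
      else 0)"

definition mat_mult :: "'b set \<Rightarrow> ('b \<Rightarrow> 'b \<Rightarrow> real) \<Rightarrow> ('b \<Rightarrow> 'b \<Rightarrow> real) \<Rightarrow> 'b \<Rightarrow> 'b \<Rightarrow> real" where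
  "mat_mult A X Y = (\<lambda>e g. \<Sum>f\<in>A. X e f * Y f g)"

definition mat_id :: "'b \<Rightarrow> 'b \<Rightarrow> real" where
  "mat_id = (\<lambda>e f. if e = f then 1 else 0)"

fun mat_pow :: "'b set \<Rightarrow> ('b \<Rightarrow> 'b \<Rightarrow> real) \<Rightarrow> nat \<Rightarrow> 'b \<Rightarrow> 'b \<Rightarrow> real" where
  "mat_pow A X 0 = mat_id"
| "mat_pow A X (Suc n) = mat_mult A X (mat_pow A X n)"

definition grover_periodic :: "'a set \<Rightarrow> ('a \<Rightarrow> 'a \<Rightarrow> bool) \<Rightarrow> bool" where
  "grover_periodic V E \<longleftrightarrow>
     (\<exists>m > 0. \<forall>e \<in> arcs V E. \<forall>f \<in> arcs V E.
        mat_pow (arcs V E) (grover V E) m e f = mat_id e f)"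

end

theory Submission
  imports Defs "Jordan_Normal_Form.Schur_Decomposition"
    "HOL-Computational_Algebra.Formal_Power_Series" "HOL-Number_Theory.Cong"
begin

text \<open>
  If \<open>U ^ m = 1\<close>, all eigenvalues of the evolution \<open>U\<close> are \<open>m\<close>-th roots of unity, so the
  coefficients of its characteristic polynomial are algebraic integers.
  Deleting a cycle edge leaves a spanning tree, which is bipartite.
  Hence a closed walk of odd length uses each cycle edge an odd number of times, so the traces
  of \<open>U ^ d\<close> vanish for odd \<open>d < k\<close>, and only the \<open>2 * k\<close> walks once around the cycle contribute
  to the trace of \<open>U ^ k\<close>, each with weight \<open>w\<close>, the product of the numbers \<open>2 / deg v\<close> over
  the cycle vertices \<open>v\<close>. By Newton's identities the \<open>k\<close>-th coefficient is \<open>-2 * w\<close>, a rational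
  algebraic integer. So \<open>2 * w\<close> is a positive integer while every cycle vertex has degree at
  least 2, which leaves only the values \<open>w = 1\<close> and \<open>w = 1/2\<close>.
\<close>

subsection \<open>Newton's identities and integrality at roots of unity\<close>

text \<open>The entry \<open>v r\<close> makes \<open>v\<close> a nonzero vector, hence an
  eigenvector of the integer matrix \<open>M\<close> for \<open>x\<close>, and the characteristic
  polynomial of \<open>M\<close> is monic with integer coefficients.\<close>

lemma algebraic_int_of_int_matrix:
  fixes x :: complex and v :: "nat \<Rightarrow> complex" and M :: "nat \<Rightarrow> nat \<Rightarrow> int"
  assumes "r < m" "v r \<noteq> 0"
    and mul: "\<And>i. i < m \<Longrightarrow> x * v i = (\<Sum>j<m. of_int (M i j) * v j)"
  shows "algebraic_int x"
proof -
  define B where "B = mat m m (\<lambda>(i,j). M i j)"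
  define C where "C = (map_mat of_int B :: complex mat)"
  have B: "B \<in> carrier_mat m m" and C: "C \<in> carrier_mat m m"
    by (auto simp: B_def C_def)
  have "eigenvector C (vec m v) x"
    unfolding eigenvector_def
  proof (intro conjI)
    show "vec m v \<in> carrier_vec (dim_row C)" using C by auto
    show "vec m v \<noteq> 0\<^sub>v (dim_row C)"
      using assms(1,2) C by (metis carrier_matD(1) index_vec index_zero_vec(1))
    show "C *\<^sub>v vec m v = x \<cdot>\<^sub>v vec m v"
      using C by (intro eq_vecI)
        (auto simp: C_def B_def scalar_prod_def mul atLeast0LessThan intro!: sum.cong)
  qed
  hence "poly (char_poly C) x = 0"
    using eigenvalue_root_char_poly[OF C, of x] by (auto simp: eigenvalue_def)
  moreover have "char_poly C = map_poly of_int (char_poly B)"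
    unfolding C_def by (rule of_int_hom.char_poly_hom[OF B])
  moreover have "lead_coeff (char_poly B) = 1"
    using degree_monic_char_poly[OF B] by simp
  ultimately show ?thesis
    unfolding algebraic_int_altdef_ipoly by auto
qed

text \<open>Multiplication by the value of \<open>p\<close> at \<open>z\<close> sends each of
  \<open>1, z, ..., z ^ (m - 1)\<close> to an integer combination of these powers, since exponents
  reduce modulo \<open>m\<close>.\<close>

lemma algebraic_int_poly_root_of_unity:
  fixes z :: complex and p :: "int poly"
  assumes "m > 0" "z ^ m = 1"
  shows "algebraic_int (poly (map_poly of_int p) z)"
proof (rule algebraic_int_of_int_matrix[where m = m and v = "\<lambda>i. z ^ i" and r = 0 and
        M = "\<lambda>i j. \<Sum>l\<le>degree p. if (l + i) mod m = j then coeff p l else 0"])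
  fix i assume "i < m"
  have zmod: "z ^ n = z ^ (n mod m)" for n
    by (metis assms(2) div_mult_mod_eq mult.commute mult.left_neutral power_add power_mult power_one)
  have "poly (map_poly of_int p) z * z ^ i = (\<Sum>l\<le>degree p. of_int (coeff p l) * z ^ (l + i))"
    by (simp add: poly_altdef sum_distrib_right power_add mult.assoc coeff_map_poly)
  also have "\<dots> = (\<Sum>l\<le>degree p. \<Sum>j<m. if (l + i) mod m = j then of_int (coeff p l) * z ^ j else 0)"
    using assms(1) by (intro sum.cong refl) (simp add: zmod[symmetric])
  also have "\<dots> = (\<Sum>j<m. \<Sum>l\<le>degree p. if (l + i) mod m = j then of_int (coeff p l) * z ^ j else 0)"
    by (rule sum.swap)
  also have "\<dots> = (\<Sum>j<m. of_int (\<Sum>l\<le>degree p. if (l + i) mod m = j then coeff p l else 0) * z ^ j)"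
    by (auto simp: sum_distrib_right intro!: sum.cong)
  finally show "poly (map_poly of_int p) z * z ^ i =
    (\<Sum>j<m. of_int (\<Sum>l\<le>degree p. if (l + i) mod m = j then coeff p l else 0) * z ^ j)" .
qed (use assms in auto)

text \<open>For the eigenvalues \<open>es\<close> of a matrix \<open>A\<close> this is
  \<open>det (1 - X A)\<close>; coefficient \<open>n\<close> is, up to sign, the \<open>n\<close>-th
  elementary symmetric polynomial in \<open>es\<close>.\<close>

definition rev_char_fps :: "complex list \<Rightarrow> complex fps" where
  "rev_char_fps es = (\<Prod>e\<leftarrow>es. 1 - fps_const e * fps_X)"

text \<open>This is the logarithmic derivative of the product with denominators cleared; the
  induction is the product rule.\<close>

lemma newton_identity_fps:
  "fps_X * fps_deriv (rev_char_fps es) =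
     - rev_char_fps es * Abs_fps (\<lambda>j. if j = 0 then 0 else (\<Sum>e\<leftarrow>es. e ^ j))"
proof (induction es)
  case Nil
  have "Abs_fps (\<lambda>j. if j = 0 then 0 else (\<Sum>e\<leftarrow>[]. e ^ j)) = (0 :: complex fps)"
    by (simp add: fps_eq_iff)
  then show ?case by (simp add: rev_char_fps_def)
next
  case (Cons e es)
  let ?q = "rev_char_fps es"
  define S where "S = (\<lambda>es::complex list. Abs_fps (\<lambda>j. if j = 0 then 0 else (\<Sum>e\<leftarrow>es. e ^ j)))"
  \<comment> \<open>\<open>G\<close> is the geometric series \<open>e X / (1 - e X)\<close>, the
    share of \<open>e\<close> in the power sums.\<close>
  define G where "G = Abs_fps (\<lambda>j. if j = 0 then 0 else e ^ j)"
  have S: "S (e # es) = G + S es"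
    by (simp add: S_def G_def fps_eq_iff)
  have G: "(1 - fps_const e * fps_X) * G = fps_const e * fps_X"
  proof -
    have "(1 - fps_const e * fps_X) * G = G - fps_const e * (fps_X * G)"
      by (simp add: algebra_simps)
    also have "\<dots> = fps_const e * fps_X"
    proof (rule fps_ext)
      fix n
      show "fps_nth (G - fps_const e * (fps_X * G)) n = fps_nth (fps_const e * fps_X) n"
        by (cases n) (auto simp: G_def fps_X_nth)
    qed
    finally show ?thesis .
  qed
  have IH: "fps_X * fps_deriv ?q = - ?q * S es"
    using Cons.IH by (simp add: S_def)
  have ring: "- a * q * s - a * g * q = - (a * q) * (g + s)" for a q s g :: "complex fps"
    by (simp add: algebra_simps)
  have "fps_X * fps_deriv ((1 - fps_const e * fps_X) * ?q) =
      (1 - fps_const e * fps_X) * (fps_X * fps_deriv ?q) - (fps_const e * fps_X) * ?q"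
  proof -
    have "fps_deriv ((1 - fps_const e * fps_X) * ?q) =
        (1 - fps_const e * fps_X) * fps_deriv ?q - fps_const e * ?q"
      by (simp add: fps_const_neg[symmetric] del: fps_const_neg)
    moreover have "x * (a * d - c * q) = a * (x * d) - (c * x) * q" for a c d q x :: "complex fps"
      by (simp add: right_diff_distrib ac_simps)
    ultimately show ?thesis by (simp only:)
  qed
  also have "\<dots> = - (1 - fps_const e * fps_X) * ?q * S es - ((1 - fps_const e * fps_X) * G) * ?q"
    unfolding G IH by (simp only: mult_minus_left mult_minus_right mult.assoc)
  also have "\<dots> = - ((1 - fps_const e * fps_X) * ?q) * S (e # es)"
    unfolding S by (rule ring)
  finally show ?case
    by (simp only: S_def rev_char_fps_def list.map prod_list.Cons)
qed

lemma newton_identity: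
  "of_nat n * fps_nth (rev_char_fps es) n = - (\<Sum>i<n. fps_nth (rev_char_fps es) i * (\<Sum>e\<leftarrow>es. e ^ (n - i)))"
proof -
  have "of_nat n * fps_nth (rev_char_fps es) n = fps_nth (fps_X * fps_deriv (rev_char_fps es)) n"
    by (cases n) simp_all
  also have "\<dots> = - (\<Sum>i=0..n. fps_nth (rev_char_fps es) i * (if n - i = 0 then 0 else (\<Sum>e\<leftarrow>es. e ^ (n - i))))"
    unfolding newton_identity_fps by (simp add: fps_mult_nth sum_negf)
  \<comment> \<open>The term \<open>i = n\<close> drops out because the series of power sums was
    given constant term 0.\<close>
  also have "(\<Sum>i=0..n. fps_nth (rev_char_fps es) i * (if n - i = 0 then 0 else (\<Sum>e\<leftarrow>es. e ^ (n - i)))) =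
      (\<Sum>i<n. fps_nth (rev_char_fps es) i * (\<Sum>e\<leftarrow>es. e ^ (n - i)))"
    by (rule sum.mono_neutral_cong_right) auto
  finally show ?thesis .
qed

lemma rev_char_fps_0: "fps_nth (rev_char_fps es) 0 = 1"
  by (induction es) (auto simp: rev_char_fps_def)

text \<open>For odd \<open>n\<close> one of \<open>i\<close> and \<open>n - i\<close> is odd, so
  each term of Newton's identity contains an odd-indexed coefficient or an odd power sum. Strong
  induction kills the odd coefficients below \<open>k\<close>; at \<open>k\<close> itself only the
  term \<open>i = 0\<close> survives.\<close>

lemma newton_identity_odd:
  assumes "odd k" and odd0: "\<And>d. odd d \<Longrightarrow> d < k \<Longrightarrow> (\<Sum>e\<leftarrow>es. e ^ d) = 0"
  shows "of_nat k * fps_nth (rev_char_fps es) k = - (\<Sum>e\<leftarrow>es. e ^ k)"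
proof -
  have q0: "fps_nth (rev_char_fps es) n = 0" if "odd n" "n < k" for n
    using that
  proof (induction n rule: less_induct)
    case (less n)
    have zero: "\<forall>i\<in>{..<n}. fps_nth (rev_char_fps es) i * (\<Sum>e\<leftarrow>es. e ^ (n - i)) = 0"
    proof
      fix i assume "i \<in> {..<n}"
      then show "fps_nth (rev_char_fps es) i * (\<Sum>e\<leftarrow>es. e ^ (n - i)) = 0"
        using less odd0[of "n - i"] by (cases "odd i") auto
    qed
    then have "of_nat n * fps_nth (rev_char_fps es) n = 0"
      unfolding newton_identity sum.neutral[OF zero] by simp
    with less.prems show ?case by (auto elim: oddE)
  qed
  have "(\<Sum>i<k. fps_nth (rev_char_fps es) i * (\<Sum>e\<leftarrow>es. e ^ (k - i))) =
        (\<Sum>i\<in>{0}. fps_nth (rev_char_fps es) i * (\<Sum>e\<leftarrow>es. e ^ (k - i)))"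
  proof (rule sum.mono_neutral_right)
    show "\<forall>i\<in>{..<k} - {0}. fps_nth (rev_char_fps es) i * (\<Sum>e\<leftarrow>es. e ^ (k - i)) = 0"
    proof
      fix i assume i: "i \<in> {..<k} - {0}"
      then show "fps_nth (rev_char_fps es) i * (\<Sum>e\<leftarrow>es. e ^ (k - i)) = 0"
        using q0[of i] odd0[of "k - i"] assms(1) by (cases "odd i") auto
    qed
  qed (use assms(1) in \<open>auto elim: oddE\<close>)
  then show ?thesis unfolding newton_identity by (simp add: rev_char_fps_0)
qed

lemma root_of_unity_power_of_primitive:
  fixes e :: complex
  assumes "m > 0" "e ^ m = 1"
  shows "\<exists>j. e = cis (2 * pi / m) ^ j"
proof -
  have "e \<in> {z. z ^ m = 1}" using assms by simp
  then obtain j :: nat where "e = cis (2 * pi * j / m)"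
    using bij_betw_roots_unity[OF assms(1)] unfolding bij_betw_def by auto
  then show ?thesis by (auto simp: DeMoivre mult_ac intro!: exI[of _ j])
qed

text \<open>All entries of \<open>es\<close> are powers of one primitive \<open>m\<close>-th root of
  unity, so multiplying out the product stays within the integer polynomials in that root. This is
  the form that \<open>algebraic_int_poly_root_of_unity\<close> accepts.\<close>

lemma rev_char_fps_int_poly:
  assumes "m > 0" "\<And>e. e \<in> set es \<Longrightarrow> e ^ m = 1"
  shows "\<exists>p :: int poly. fps_nth (rev_char_fps es) n = poly (map_poly of_int p) (cis (2 * pi / m))"
  using assms(2)
proof (induction es arbitrary: n)
  case Nil
  then show ?case by (auto simp: rev_char_fps_def intro: exI[of _ 0] exI[of _ 1])
next
  case (Cons e es)
  let ?h = "\<lambda>p :: int poly. poly (map_poly of_int p) (cis (2 * pi / m))"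
  obtain j where j: "e = cis (2 * pi / m) ^ j"
    using root_of_unity_power_of_primitive[OF assms(1), of e] Cons.prems by auto
  then have e: "e = ?h (monom 1 j)" by (simp add: map_poly_monom poly_monom)
  obtain p where p: "fps_nth (rev_char_fps es) n = ?h p" using Cons by auto
  obtain p' where p': "fps_nth (rev_char_fps es) (n - 1) = ?h p'" using Cons by (meson list.set_intros(2))
  have "fps_nth (rev_char_fps (e # es)) n = fps_nth (rev_char_fps es) n - (if n = 0 then 0 else e * fps_nth (rev_char_fps es) (n - 1))"
  proof -
    have "rev_char_fps (e # es) = rev_char_fps es - fps_const e * (fps_X * rev_char_fps es)"
      by (simp add: rev_char_fps_def algebra_simps)
    then show ?thesis by simp
  qed
  also have "\<dots> = ?h (p - (if n = 0 then 0 else monom 1 j * p'))"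
    by (auto simp: p p'[unfolded One_nat_def] e hom_distribs)
  finally show ?case by blast
qed


section \<open>Traces of matrix powers as power sums of eigenvalues\<close>

definition mat_trace :: "'a::comm_ring_1 mat \<Rightarrow> 'a" where
  "mat_trace A = (\<Sum>i<dim_row A. A $$ (i, i))"

lemma mat_trace_mult_commute:
  assumes "A \<in> carrier_mat n l" "B \<in> carrier_mat l n"
  shows "mat_trace (A * B) = mat_trace (B * A)"
proof -
  have "mat_trace (A * B) = (\<Sum>i<n. \<Sum>j<l. A $$ (i, j) * B $$ (j, i))"
    using assms by (auto simp: mat_trace_def scalar_prod_def atLeast0LessThan intro!: sum.cong)
  also have "\<dots> = (\<Sum>j<l. \<Sum>i<n. B $$ (j, i) * A $$ (i, j))"
    by (subst sum.swap) (simp add: mult.commute)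
  also have "\<dots> = mat_trace (B * A)"
    using assms by (auto simp: mat_trace_def scalar_prod_def atLeast0LessThan intro!: sum.cong)
  finally show ?thesis .
qed

lemma upper_triangular_pow:
  fixes B :: "'a::comm_ring_1 mat"
  assumes "B \<in> carrier_mat n n" "upper_triangular B"
  shows "upper_triangular (B ^\<^sub>m j) \<and> (\<forall>i<n. (B ^\<^sub>m j) $$ (i, i) = B $$ (i, i) ^ j)"
proof (induction j)
  case 0
  then show ?case using assms by auto
next
  case (Suc j)
  have Bj: "B ^\<^sub>m j \<in> carrier_mat n n" using assms by simp
  have entry: "(B ^\<^sub>m Suc j) $$ (i, l) = (\<Sum>r<n. (B ^\<^sub>m j) $$ (i, r) * B $$ (r, l))"
    if "i < n" "l < n" for i l
    using assms Bj that by (auto simp: scalar_prod_def atLeast0LessThan intro!: sum.cong)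
  have zero: "(B ^\<^sub>m j) $$ (i, r) * B $$ (r, l) = 0" if "i < n" "l < n" "r < n" "r < i \<or> l < r" for i l r
    using that Suc.IH Bj assms upper_triangularD[of "B ^\<^sub>m j" r i] upper_triangularD[of B l r] by auto
  have "(B ^\<^sub>m Suc j) $$ (i, l) = 0" if "l < i" "i < n" for i l
    unfolding entry[OF that(2) less_trans[OF that]]
    using that by (intro sum.neutral) (metis lessThan_iff less_trans linorder_neqE_nat zero)
  moreover have "(B ^\<^sub>m Suc j) $$ (i, i) = B $$ (i, i) ^ Suc j" if "i < n" for i
  proof -
    have "(B ^\<^sub>m Suc j) $$ (i, i) = (\<Sum>r\<in>{i}. (B ^\<^sub>m j) $$ (i, r) * B $$ (r, i))"
      unfolding entry[OF that that]
      using that zero[of i i] by (intro sum.mono_neutral_right) (auto simp: neq_iff)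
    then show ?thesis using Suc.IH that by (simp add: mult.commute)
  qed
  ultimately show ?case using assms Bj by (auto intro!: upper_triangularI)
qed

text \<open>By Schur decomposition \<open>A\<close> is similar to an upper triangular
  \<open>B\<close>, and \<open>es\<close> is the diagonal of \<open>B\<close>. Both claims stand in
  one statement because they must hold for the same list.\<close>

lemma trace_power_eigenvalues:
  fixes A :: "complex mat"
  assumes A: "A \<in> carrier_mat n n"
  shows "\<exists>es. (\<forall>j. mat_trace (A ^\<^sub>m j) = (\<Sum>e\<leftarrow>es. e ^ j)) \<and>
              (\<forall>m. A ^\<^sub>m m = 1\<^sub>m n \<longrightarrow> (\<forall>e\<in>set es. e ^ m = 1))"
proof -
  obtain es0 where "char_poly A = (\<Prod>a\<leftarrow>es0. [:- a, 1:])"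
    using char_poly_factorized[OF A] by auto
  then obtain B where B: "B \<in> carrier_mat n n" "upper_triangular B" "similar_mat A B"
    using schur_decomposition_exists[OF A] by blast
  then obtain P Q where wit: "similar_mat_wit A B P Q" unfolding similar_mat_def by auto
  note PQ = similar_mat_witD2[OF A wit]
  have Bj: "B ^\<^sub>m j \<in> carrier_mat n n" for j using B by simp
  define es where "es = map (\<lambda>i. B $$ (i, i)) [0..<n]"
  have "mat_trace (A ^\<^sub>m j) = (\<Sum>e\<leftarrow>es. e ^ j)" for j
  proof -
    have "mat_trace (A ^\<^sub>m j) = mat_trace (P * (B ^\<^sub>m j * Q))"
      using similar_mat_wit_pow_id[OF wit, of j] PQ Bj[of j] by (simp add: assoc_mult_mat[of _ n n _ n _ n])
    also have "\<dots> = mat_trace (B ^\<^sub>m j * Q * P)"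
      using PQ Bj[of j] by (intro mat_trace_mult_commute[of _ n n]) auto
    also have "B ^\<^sub>m j * Q * P = B ^\<^sub>m j"
      using PQ Bj[of j] by (simp add: assoc_mult_mat[of _ n n _ n _ n])
    also have "mat_trace (B ^\<^sub>m j) = (\<Sum>i<n. B $$ (i, i) ^ j)"
      using upper_triangular_pow[OF B(1,2)] B by (simp add: mat_trace_def)
    also have "\<dots> = (\<Sum>e\<leftarrow>es. e ^ j)"
      by (simp add: es_def o_def interv_sum_list_conv_sum_set_nat atLeast0LessThan)
    finally show ?thesis .
  qed
  moreover have "\<forall>e\<in>set es. e ^ m = 1" if "A ^\<^sub>m m = 1\<^sub>m n" for m
  proof -
    have "B ^\<^sub>m m = Q * 1\<^sub>m n * P"
      using similar_mat_wit_pow_id[OF similar_mat_wit_sym[OF wit], of m] that by simp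
    then have "B ^\<^sub>m m = 1\<^sub>m n" using PQ by simp
    then have "B $$ (i, i) ^ m = 1" if "i < n" for i
      using upper_triangular_pow[OF B(1,2), of m] that by (metis index_one_mat(1))
    then show ?thesis by (auto simp: es_def)
  qed
  ultimately show ?thesis by blast
qed

text \<open>\<open>^\<^sub>m\<close> unfolds with the new factor on the right,
  \<open>mat_pow\<close> with it on the left.\<close>

lemma pow_mat_Suc_left:
  assumes A: "A \<in> carrier_mat n n"
  shows "A ^\<^sub>m Suc j = A * A ^\<^sub>m j"
proof (induction j)
  case 0
  show ?case using A by simp
next
  case (Suc j)
  have "A ^\<^sub>m Suc (Suc j) = (A * A ^\<^sub>m j) * A"
    by (simp only: pow_mat.simps(2)[of A "Suc j"] Suc)
  also have "\<dots> = A * A ^\<^sub>m Suc j"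
    using A by (simp add: assoc_mult_mat[of _ n n _ n _ n])
  finally show ?case .
qed

text \<open>Enumerating the index set by \<open>g\<close> carries \<open>mat_pow\<close> over to
  matrices with numbered rows, where the eigenvalue argument applies.\<close>

lemma sum_diag_mat_pow:
  assumes "finite A"
  shows "\<exists>n. \<exists>M \<in> carrier_mat n n. (\<forall>j. mat_trace (M ^\<^sub>m j) = complex_of_real (\<Sum>e\<in>A. mat_pow A X j e e)) \<and>
     (\<forall>m. (\<forall>e\<in>A. \<forall>f\<in>A. mat_pow A X m e f = mat_id e f) \<longrightarrow> M ^\<^sub>m m = 1\<^sub>m n)"
proof -
  obtain g where g: "bij_betw g {..<card A} A"
    using assms ex_bij_betw_nat_finite[of A] by (auto simp: atLeast0LessThan)
  define n where "n = card A"
  note g = g[folded n_def]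
  have gA: "g i \<in> A" if "i < n" for i using g that by (auto simp: bij_betw_def)
  have inj: "g i = g l \<longleftrightarrow> i = l" if "i < n" "l < n" for i l
    using g that by (auto simp: bij_betw_def inj_on_def)
  define M where "M = mat n n (\<lambda>(i,j). complex_of_real (X (g i) (g j)))"
  have M: "M \<in> carrier_mat n n" by (simp add: M_def)
  then have Mj: "M ^\<^sub>m j \<in> carrier_mat n n" for j by simp
  have entry: "\<forall>i<n. \<forall>l<n. (M ^\<^sub>m j) $$ (i, l) = complex_of_real (mat_pow A X j (g i) (g l))" for j
  proof (induction j)
    case 0
    show ?case
      using M by (simp add: mat_id_def inj)
  next
    case (Suc j)
    show ?case
    proof (intro allI impI)
      fix i l assume il: "i < n" "l < n"
      have "M ^\<^sub>m Suc j = M * M ^\<^sub>m j"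
        by (rule pow_mat_Suc_left[OF M])
      then have "(M ^\<^sub>m Suc j) $$ (i, l) = (\<Sum>r<n. M $$ (i, r) * (M ^\<^sub>m j) $$ (r, l))"
        using il M Mj[of j] by (auto simp: scalar_prod_def atLeast0LessThan intro!: sum.cong)
      also have "\<dots> = (\<Sum>r<n. complex_of_real (X (g i) (g r) * mat_pow A X j (g r) (g l)))"
        using il Suc by (intro sum.cong) (auto simp: M_def)
      also have "\<dots> = (\<Sum>f\<in>A. complex_of_real (X (g i) f * mat_pow A X j f (g l)))"
        by (rule sum.reindex_bij_betw[OF g])
      finally show "(M ^\<^sub>m Suc j) $$ (i, l) = complex_of_real (mat_pow A X (Suc j) (g i) (g l))"
        by (simp add: mat_mult_def)
    qed
  qed
  have "mat_trace (M ^\<^sub>m j) = complex_of_real (\<Sum>e\<in>A. mat_pow A X j e e)" for j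
  proof -
    have "mat_trace (M ^\<^sub>m j) = (\<Sum>i<n. complex_of_real (mat_pow A X j (g i) (g i)))"
      unfolding mat_trace_def using M Mj[of j] entry[of j] by (intro sum.cong) simp_all
    also have "\<dots> = (\<Sum>e\<in>A. complex_of_real (mat_pow A X j e e))"
      by (rule sum.reindex_bij_betw[OF g])
    finally show ?thesis by simp
  qed
  moreover have "M ^\<^sub>m m = 1\<^sub>m n" if "\<forall>e\<in>A. \<forall>f\<in>A. mat_pow A X m e f = mat_id e f" for m
  proof (rule eq_matI)
    fix i l assume "i < dim_row (1\<^sub>m n :: complex mat)" "l < dim_col (1\<^sub>m n :: complex mat)"
    then have il: "i < n" "l < n" by simp_all
    then have "(M ^\<^sub>m m) $$ (i, l) = complex_of_real (mat_id (g i) (g l))"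
      using entry[of m] that gA by simp
    with il show "(M ^\<^sub>m m) $$ (i, l) = 1\<^sub>m n $$ (i, l)"
      by (simp add: mat_id_def inj)
  qed (use Mj[of m] in auto)
  ultimately show ?thesis using M by blast
qed

text \<open>By \<open>newton_identity_odd\<close> the quotient is minus the \<open>k\<close>-th
  coefficient of \<open>rev_char_fps\<close>, an algebraic integer; a rational algebraic integer is
  an integer.\<close>

lemma periodic_odd_trace_divisible:
  fixes X :: "'b \<Rightarrow> 'b \<Rightarrow> real"
  assumes "finite A" "m > 0" and id: "\<forall>e\<in>A. \<forall>f\<in>A. mat_pow A X m e f = mat_id e f"
    and "odd k" and odd0: "\<And>d. odd d \<Longrightarrow> d < k \<Longrightarrow> (\<Sum>e\<in>A. mat_pow A X d e e) = 0"
    and rat: "(\<Sum>e\<in>A. mat_pow A X k e e) \<in> \<rat>"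
  shows "(\<Sum>e\<in>A. mat_pow A X k e e) / k \<in> \<int>"
proof -
  define T where "T = (\<lambda>j. \<Sum>e\<in>A. mat_pow A X j e e)"
  obtain es where tr: "\<And>j. complex_of_real (T j) = (\<Sum>e\<leftarrow>es. e ^ j)"
    and root: "\<And>e. e \<in> set es \<Longrightarrow> e ^ m = 1"
    using sum_diag_mat_pow[OF assms(1), of X] trace_power_eigenvalues id unfolding T_def by metis
  have "k > 0" using assms(4) by (auto elim: oddE)
  have "(\<Sum>e\<leftarrow>es. e ^ d) = 0" if "odd d" "d < k" for d
    using tr[of d] odd0[OF that] by (simp add: T_def)
  from newton_identity_odd[OF assms(4) this]
  have "- fps_nth (rev_char_fps es) k = complex_of_real (T k / k)"
    using \<open>k > 0\<close> by (simp add: tr[symmetric] field_simps)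
  moreover have "algebraic_int (fps_nth (rev_char_fps es) k)"
    using rev_char_fps_int_poly[OF assms(2) root, of es k]
      algebraic_int_poly_root_of_unity[of m "cis (2 * pi / m)"] assms(2)
    by (auto simp: DeMoivre)
  ultimately have "algebraic_int (T k / k)"
    by (metis algebraic_int_minus_iff algebraic_int_of_real_iff)
  then show ?thesis
    using rat rational_algebraic_int_is_int[of "T k / k"] unfolding T_def by auto
qed

subsection \<open>Cuts of a unicyclic graph\<close>

text \<open>
  In a tree the edges are exactly the pairs (parent, vertex) of a breadth-first search from a
  root, so the parity of the distance to the root is a proper 2-colouring.
\<close>

lemma tree_bipartite:
  assumes G: "simple_graph V E" and conn: "connected_graph V E"
    and card: "card V = Suc (card (edges V E))"
  shows "bipartite V E"
proof -
  have fin: "finite V" using G by (simp add: simple_graph_def)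
  obtain r where r: "r \<in> V" using G by (auto simp: simple_graph_def)
  have EV: "x \<in> V" "y \<in> V" if "E x y" for x y
    using G that by (auto simp: simple_graph_def)
  define d where "d = (\<lambda>v. LEAST n. (E ^^ n) r v)"
  have d_le: "d v \<le> n" if "(E ^^ n) r v" for v n
    using that unfolding d_def by (rule Least_le)
  have walk: "(E ^^ d v) r v" if "v \<in> V" for v
    using conn r that unfolding connected_graph_def d_def by (metis LeastI rtranclp_imp_relpowp)
  have "\<exists>p. E p v \<and> d v = Suc (d p)" if v: "v \<in> V" "v \<noteq> r" for v
  proof -
    obtain n where n: "d v = Suc n" using walk v by (cases "d v") fastforce+
    then obtain p where p: "(E ^^ n) r p" "E p v" using walk[OF v(1)] by auto
    have "d p \<le> n" using p(1) by (rule d_le)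
    moreover have "(E ^^ Suc (d p)) r v" using walk[of p] p(2) EV by auto
    then have "d v \<le> Suc (d p)" by (rule d_le)
    ultimately show ?thesis using n p(2) by auto
  qed
  then obtain p where p: "\<And>v. v \<in> V \<Longrightarrow> v \<noteq> r \<Longrightarrow> E (p v) v \<and> d v = Suc (d (p v))"
    by metis
  let ?f = "\<lambda>v. {p v, v}"
  \<comment> \<open>Two vertices with the same parent edge would be parents of each other, which the
    distances forbid.\<close>
  have "inj_on ?f (V - {r})"
  proof (rule inj_onI)
    fix v w assume vw: "v \<in> V - {r}" "w \<in> V - {r}" "?f v = ?f w"
    have dv: "d v = Suc (d (p v))" and dw: "d w = Suc (d (p w))"
      using p[of v] p[of w] vw(1,2) by blast+
    from vw(3) have "v = w \<or> p v = w \<and> p w = v"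
      by (auto simp: doubleton_eq_iff)
    moreover have False if "p v = w" "p w = v"
      using dv dw unfolding that by linarith
    ultimately show "v = w" by blast
  qed
  \<comment> \<open>There are as many parent edges as edges in all, so every edge joins a vertex to
    its parent.\<close>
  then have "card (?f ` (V - {r})) = card (edges V E)"
    using card r fin by (simp add: card_image)
  moreover have "?f ` (V - {r}) \<subseteq> edges V E"
    using p EV unfolding edges_def by blast
  moreover have "finite (edges V E)"
    by (rule finite_subset[of _ "Pow V"]) (use fin in \<open>auto simp: edges_def\<close>)
  ultimately have all: "?f ` (V - {r}) = edges V E"
    by (metis card_subset_eq)
  have "x \<in> {v. even (d v)} \<longleftrightarrow> y \<notin> {v. even (d v)}" if "E x y" for x y
  proof -
    have "{x, y} \<in> edges V E" using that EV unfolding edges_def by blast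
    then obtain v where v: "v \<in> V - {r}" "{x, y} = {p v, v}" using all by auto
    then have "even (d v) \<longleftrightarrow> odd (d (p v))" using p[of v] by (metis DiffD1 DiffD2 even_Suc insertI1)
    then show ?thesis using v(2) by (auto simp: doubleton_eq_iff)
  qed
  then show ?thesis unfolding bipartite_def by blast
qed

text \<open>
  The cycle is extended periodically to all indices, which avoids case distinctions at the
  wrap-around and makes the reversed orientation \<open>\<lambda>n. c (n * (k - 1))\<close> another instance.
\<close>

locale unicycle =
  fixes V :: "'a set" and E :: "'a \<Rightarrow> 'a \<Rightarrow> bool" and k :: nat and c :: "nat \<Rightarrow> 'a"
  assumes unicycle: "odd_unicycle V E"
    and k3: "k \<ge> 3" and odd_k: "odd k"
    and c_eq_iff: "c a = c b \<longleftrightarrow> a mod k = b mod k"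
    and c_adj: "E (c a) (c (Suc a))"
begin

definition cyc_edge :: "nat \<Rightarrow> 'a set" where
  "cyc_edge n = {c n, c (Suc n)}"

text \<open>
  The arcs point against the orientation of \<open>c\<close>, because the index sequence of a nonzero product of
  entries of \<open>grover\<close>, read from left to right, runs backwards in time.
\<close>

definition cyc_arc :: "nat \<Rightarrow> 'a \<times> 'a" where
  "cyc_arc n = (c (Suc n), c n)"

lemma graph: "simple_graph V E"
  using unicycle by (simp add: odd_unicycle_def)

lemma finite_V: "finite V"
  using graph by (simp add: simple_graph_def)

lemma adj_V: "E x y \<Longrightarrow> x \<in> V" "E x y \<Longrightarrow> y \<in> V"
  using graph by (auto simp: simple_graph_def)

lemma adj_sym: "E x y \<Longrightarrow> E y x"
  using graph by (auto simp: simple_graph_def)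

lemma c_V: "c a \<in> V"
  using c_adj adj_V by blast

lemma finite_arcs: "finite (arcs V E)"
  by (rule finite_subset[of _ "V \<times> V"]) (auto simp: arcs_def finite_V)

lemma c_Suc_eq_iff: "c (Suc a) = c (Suc b) \<longleftrightarrow> c a = c b"
  using cong_add_rcancel_nat[of a 1 b k] by (simp add: c_eq_iff cong_def)

lemma c_add_eq_iff: "c (s + a) = c (s + b) \<longleftrightarrow> c a = c b"
  by (induction s) (simp_all add: c_Suc_eq_iff)

lemma c_add_k: "c (a + k) = c a"
  by (simp add: c_eq_iff)

lemma c_mod: "c (a mod k) = c a"
  by (simp add: c_eq_iff)

lemma c_Suc_Suc_neq: "c (Suc (Suc a)) \<noteq> c a"
proof
  assume "c (Suc (Suc a)) = c a"
  then have "c (a + 2) = c (a + 0)" by simp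
  then have "c 2 = c 0" by (simp only: c_add_eq_iff)
  then show False using k3 by (simp add: c_eq_iff)
qed

lemma c_inj_on: "inj_on c {..<k}"
  by (auto simp: inj_on_def c_eq_iff)

lemma range_c: "range c = c ` {..<k}"
proof -
  have "c a \<in> c ` {..<k}" for a
    using k3 by (intro image_eqI[of _ _ "a mod k"]) (auto simp: c_mod)
  then show ?thesis by auto
qed

lemma card_range_c: "card (range c) = k"
  by (simp add: range_c card_image c_inj_on)

lemma cyc_edge_eq_iff: "cyc_edge a = cyc_edge b \<longleftrightarrow> c a = c b"
  using c_Suc_eq_iff[of a b] c_Suc_Suc_neq[of a] c_Suc_eq_iff[of "Suc a" b]
  by (fastforce simp: cyc_edge_def doubleton_eq_iff)

text \<open>Deleting the cycle edge leaves a connected graph with one edge fewer than vertices, a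
  tree; \<open>S\<close> is one of its colour classes.\<close>

lemma cycle_edge_cut:
  "\<exists>S. \<forall>x y. E x y \<longrightarrow> ((x \<in> S \<longleftrightarrow> y \<in> S) \<longleftrightarrow> {x, y} = cyc_edge i)"
proof -
  define E' where "E' = (\<lambda>x y. E x y \<and> {x, y} \<noteq> cyc_edge i)"
  have E'_sym: "E' x y \<Longrightarrow> E' y x" for x y
    by (auto simp: E'_def adj_sym insert_commute)
  \<comment> \<open>The detour: the \<open>k - 1\<close> cycle edges that follow
    \<open>cyc_edge i\<close> all survive its deletion.\<close>
  have path: "E'\<^sup>*\<^sup>* (c (Suc i)) (c (Suc i + j))" if "j < k" for j
    using that
  proof (induction j)
    case (Suc j)
    have "c (Suc i + j) \<noteq> c i"
    proof
      assume "c (Suc i + j) = c i"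
      then have "c (i + Suc j) = c (i + 0)" by simp
      then have "c (Suc j) = c 0" by (simp only: c_add_eq_iff)
      then show False using Suc.prems by (simp add: c_eq_iff)
    qed
    then have "E' (c (Suc i + j)) (c (Suc i + Suc j))"
      using c_adj[of "Suc i + j"] cyc_edge_eq_iff[of "Suc i + j" i]
      by (simp add: E'_def cyc_edge_def)
    then show ?case using Suc by (meson Suc_lessD rtranclp.rtrancl_into_rtrancl)
  qed simp
  have "c (Suc i + (k - 1)) = c i"
    using k3 c_add_k[of i] by simp
  then have bypass: "E'\<^sup>*\<^sup>* (c (Suc i)) (c i)"
    using path[of "k - 1"] k3 by simp
  have "symp E'" using E'_sym by (auto intro: sympI)
  then have bypass': "E'\<^sup>*\<^sup>* (c i) (c (Suc i))"
    using bypass by (metis symp_rtranclp sympD)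
  have step: "E'\<^sup>*\<^sup>* x y" if "E x y" for x y
    using that bypass bypass' by (cases "{x, y} = cyc_edge i")
      (auto simp: E'_def cyc_edge_def doubleton_eq_iff)
  have "E'\<^sup>*\<^sup>* x y" if "E\<^sup>*\<^sup>* x y" for x y
    using that by induction (auto intro: rtranclp_trans step)
  then have conn: "connected_graph V E'"
    using unicycle by (auto simp: odd_unicycle_def connected_graph_def)
  have simple: "simple_graph V E'"
    using graph E'_sym by (auto simp: simple_graph_def E'_def)
  have edges': "edges V E' = edges V E - {cyc_edge i}"
    by (auto simp: edges_def E'_def)
  have mem: "cyc_edge i \<in> edges V E"
    using c_adj[of i] c_V by (auto simp: edges_def cyc_edge_def)
  have fin: "finite (edges V E)"
    by (rule finite_subset[of _ "Pow V"]) (auto simp: edges_def finite_V)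
  have "card V = Suc (card (edges V E'))"
    using unicycle card_Suc_Diff1[OF fin mem] by (simp add: edges' odd_unicycle_def)
  from tree_bipartite[OF simple conn this] obtain S
    where S: "\<And>x y. E' x y \<Longrightarrow> x \<in> S \<longleftrightarrow> y \<notin> S"
    unfolding bipartite_def by blast
  \<comment> \<open>If the ends of the deleted edge had different colours, \<open>S\<close> would
    2-colour the whole graph.\<close>
  have S_cyc: "c i \<in> S \<longleftrightarrow> c (Suc i) \<in> S"
  proof (rule ccontr)
    assume neq: "\<not> ?thesis"
    have "x \<in> S \<longleftrightarrow> y \<notin> S" if "E x y" for x y
      using that S[of x y] neq by (auto simp: E'_def cyc_edge_def doubleton_eq_iff)
    then have "bipartite V E" unfolding bipartite_def by blast
    then show False using unicycle by (simp add: odd_unicycle_def)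
  qed
  have "(x \<in> S \<longleftrightarrow> y \<in> S) \<longleftrightarrow> {x, y} = cyc_edge i" if "E x y" for x y
    using that S[of x y] S_cyc by (auto simp: E'_def cyc_edge_def doubleton_eq_iff)
  then show ?thesis by blast
qed

end

subsection \<open>Closed walks and traces\<close>

fun walk_weight :: "('b \<Rightarrow> 'b \<Rightarrow> real) \<Rightarrow> 'b \<Rightarrow> 'b list \<Rightarrow> real" where
  "walk_weight X e [] = 1"
| "walk_weight X e (x # xs) = X e x * walk_weight X x xs"

text \<open>The start \<open>e\<close> is kept outside the list, so that the length of
  \<open>xs\<close> counts the factors and \<open>last (e # xs)\<close> also covers the empty
  walk.\<close>

lemma mat_pow_eq_sum_walks:
  assumes "finite A"
  shows "mat_pow A X n e g =
    (\<Sum>xs | set xs \<subseteq> A \<and> length xs = n. if last (e # xs) = g then walk_weight X e xs else 0)"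
proof (induction n arbitrary: e)
  case 0
  have "{xs. set xs \<subseteq> A \<and> length xs = 0} = {[]}" by auto
  then show ?case by (simp add: mat_id_def)
next
  case (Suc n)
  let ?L = "{xs. set xs \<subseteq> A \<and> length xs = n}"
  let ?h = "\<lambda>e xs. if last (e # xs) = g then walk_weight X e xs else 0"
  have "mat_pow A X (Suc n) e g = (\<Sum>x\<in>A. \<Sum>xs\<in>?L. X e x * ?h x xs)"
    by (simp add: mat_mult_def Suc sum_distrib_left)
  also have "\<dots> = (\<Sum>xs\<in>?L. \<Sum>x\<in>A. X e x * ?h x xs)"
    by (rule sum.swap)
  also have "\<dots> = (\<Sum>p\<in>?L \<times> A. ?h e (snd p # fst p))"
    unfolding sum.cartesian_product by (intro sum.cong) auto
  also have "\<dots> = (\<Sum>xs\<in>(\<lambda>p. snd p # fst p) ` (?L \<times> A). ?h e xs)"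
    by (subst sum.reindex) (auto simp: inj_on_def)
  also have "(\<lambda>p. snd p # fst p) ` (?L \<times> A) = {xs. set xs \<subseteq> A \<and> length xs = Suc n}"
    by (simp add: lists_length_Suc_eq case_prod_unfold)
  finally show ?case .
qed

lemma walk_weight_eq_prod:
  "walk_weight X e xs = (\<Prod>j<length xs. X ((e # xs) ! j) (xs ! j))"
proof (induction xs arbitrary: e)
  case (Cons x xs)
  show ?case
    by (simp add: Cons prod.lessThan_Suc_shift del: prod.lessThan_Suc)
qed simp

lemma grover_nonzero: "grover V E e x \<noteq> 0 \<Longrightarrow> snd x = fst e"
  by (auto simp: grover_def split: if_splits)

lemma grover_walk_linked:
  assumes "walk_weight (grover V E) e xs \<noteq> 0" "j < length xs"
  shows "snd (xs ! j) = fst ((e # xs) ! j)"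
proof -
  have "grover V E ((e # xs) ! j) (xs ! j) \<noteq> 0"
    using assms unfolding walk_weight_eq_prod by (simp only: prod_zero_iff finite_lessThan) blast
  then show ?thesis by (rule grover_nonzero)
qed

text \<open>Each arc ends at the origin of its predecessor in the list, so the origin changes sides
  of \<open>S\<close> exactly at the crossing arcs.\<close>

lemma walk_crossing_parity:
  assumes "walk_weight (grover V E) e xs \<noteq> 0"
  shows "even (length (filter (\<lambda>x. fst x \<in> S \<longleftrightarrow> snd x \<notin> S) xs)) \<longleftrightarrow>
    (fst (last (e # xs)) \<in> S \<longleftrightarrow> fst e \<in> S)"
  using assms
proof (induction xs arbitrary: e)
  case (Cons x xs)
  have "snd x = fst e" using Cons.prems grover_nonzero[of V E e x] by auto
  moreover have "walk_weight (grover V E) x xs \<noteq> 0" using Cons.prems by auto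
  ultimately show ?case using Cons.IH[of x] by auto
qed simp

section \<open>Odd closed walks in a unicyclic graph\<close>

context unicycle
begin

text \<open>A closed walk crosses a cut an even number of times, so one of odd length has a
  non-crossing arc; for the cut of \<open>cycle_edge_cut\<close> that arc can only lie on the chosen
  cycle edge.\<close>

lemma closed_walk_uses_cycle_edge:
  assumes xs: "set xs \<subseteq> arcs V E" "odd (length xs)"
    and closed: "last (e # xs) = e" and wt: "walk_weight (grover V E) e xs \<noteq> 0"
  shows "\<exists>x\<in>set xs. {fst x, snd x} = cyc_edge i"
proof -
  obtain S where S: "\<And>x y. E x y \<Longrightarrow> (x \<in> S \<longleftrightarrow> y \<in> S) \<longleftrightarrow> {x, y} = cyc_edge i"
    using cycle_edge_cut[of i] by blast
  let ?cross = "\<lambda>x::'a \<times> 'a. fst x \<in> S \<longleftrightarrow> snd x \<notin> S"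
  have "even (length (filter ?cross xs))"
    using walk_crossing_parity[OF wt, of S] closed by simp
  then have "filter ?cross xs \<noteq> xs"
    using xs(2) by metis
  then obtain x where x: "x \<in> set xs" "\<not> ?cross x"
    using filter_True[of xs ?cross] by blast
  then have "E (fst x) (snd x)" using xs(1) by (auto simp: arcs_def)
  from S[OF this] x(2) have "{fst x, snd x} = cyc_edge i" by blast
  with x(1) show ?thesis ..
qed

lemma cyc_edge_image: "card (cyc_edge ` {..<k}) = k"
  by (simp add: card_image inj_on_def cyc_edge_eq_iff c_eq_iff)

lemma closed_walk_cyc_edges:
  assumes xs: "set xs \<subseteq> arcs V E" "odd (length xs)"
    and closed: "last (e # xs) = e" and wt: "walk_weight (grover V E) e xs \<noteq> 0"
  shows "cyc_edge ` {..<k} \<subseteq> set (map (\<lambda>x. {fst x, snd x}) xs)" and "k \<le> length xs"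
proof -
  show sub: "cyc_edge ` {..<k} \<subseteq> set (map (\<lambda>x. {fst x, snd x}) xs)"
    using closed_walk_uses_cycle_edge[OF assms] by fastforce
  have "k \<le> card (set (map (\<lambda>x. {fst x, snd x}) xs))"
    using card_mono[OF _ sub] by (simp add: cyc_edge_image)
  also have "\<dots> \<le> length xs"
    using card_length[of "map (\<lambda>x. {fst x, snd x}) xs"] by simp
  finally show "k \<le> length xs" .
qed

text \<open>The bound of \<open>closed_walk_cyc_edges\<close> is tight here: \<open>k\<close> arcs
  have to cover \<open>k\<close> distinct cycle edges.\<close>

lemma closed_walk_girth:
  assumes xs: "set xs \<subseteq> arcs V E" "length xs = k"
    and closed: "last (e # xs) = e" and wt: "walk_weight (grover V E) e xs \<noteq> 0"
  shows "set (map (\<lambda>x. {fst x, snd x}) xs) = cyc_edge ` {..<k}"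
    and "distinct (map (\<lambda>x. {fst x, snd x}) xs)"
proof -
  let ?es = "map (\<lambda>x. {fst x, snd x}) xs"
  have sub: "cyc_edge ` {..<k} \<subseteq> set ?es"
    using closed_walk_cyc_edges(1)[OF xs(1) _ closed wt] odd_k xs(2) by simp
  have "k \<le> card (set ?es)" using card_mono[OF _ sub] by (simp add: cyc_edge_image)
  then have card: "card (set ?es) = k" using card_length[of ?es] xs(2) by simp
  show "set ?es = cyc_edge ` {..<k}"
    using card_subset_eq[OF _ sub] card by (simp add: cyc_edge_image)
  show "distinct ?es" using card xs(2) by (intro card_distinct) simp
qed

lemma cyc_arc_edge: "{fst (cyc_arc n), snd (cyc_arc n)} = cyc_edge n"
  by (auto simp: cyc_arc_def cyc_edge_def)

text \<open>The next arc must end where the current one begins and lie on a cycle edge not yet used,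
  which leaves only the next edge of the cycle.\<close>

lemma closed_walk_unique:
  assumes xs: "set xs \<subseteq> arcs V E" "length xs = k" and e: "e = cyc_arc a"
    and closed: "last (e # xs) = e" and wt: "walk_weight (grover V E) e xs \<noteq> 0"
  shows "j \<le> k \<Longrightarrow> (e # xs) ! j = cyc_arc (a + j)"
proof (induction j)
  case 0
  show ?case by (simp add: e)
next
  case (Suc j)
  note walk = closed_walk_girth[OF xs closed wt]
  have jk: "j < k" using Suc.prems by simp
  define y where "y = xs ! j"
  have prev: "(e # xs) ! j = cyc_arc (a + j)" using Suc by simp
  have y_snd: "snd y = c (Suc (a + j))"
    using grover_walk_linked[OF wt, of j] jk xs(2) prev by (simp add: y_def cyc_arc_def)
  have "{fst y, snd y} \<in> cyc_edge ` {..<k}"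
    using jk xs(2) unfolding walk(1)[symmetric] y_def by simp
  then obtain b where b: "{fst y, snd y} = cyc_edge b" by blast
  have "\<not> {fst y, snd y} = cyc_edge (a + j)"
  proof
    assume same: "{fst y, snd y} = cyc_edge (a + j)"
    have dist: "i = j" if "i < k" "(e # xs) ! j = xs ! i" for i
    proof -
      have "map (\<lambda>x. {fst x, snd x}) xs ! i = map (\<lambda>x. {fst x, snd x}) xs ! j"
        using same that jk xs(2) prev cyc_arc_edge[of "a + j"] by (simp add: y_def)
      then show ?thesis
        using walk(2) that jk xs(2) by (simp only: nth_eq_iff_index_eq length_map)
    qed
    \<comment> \<open>The arc preceding \<open>y\<close> also occurs in \<open>xs\<close>: as the
      last entry if it is the start \<open>e\<close>, because the walk is closed, and just before
      \<open>y\<close> otherwise. Its edge would then occur twice.\<close>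
    show False
    proof (cases j)
      case 0
      have "xs \<noteq> []" using xs(2) k3 by auto
      then have "e = xs ! (k - 1)"
        using closed xs(2) by (simp add: last_conv_nth)
      then show False using dist[of "k - 1"] 0 k3 by simp
    next
      case (Suc i)
      then show False using dist[of i] jk by simp
    qed
  qed
  then have "c (a + j) \<noteq> c b"
    unfolding b cyc_edge_eq_iff by (rule not_sym)
  then have "snd y \<noteq> c (Suc b)"
    unfolding y_snd c_Suc_eq_iff .
  then have y: "snd y = c b" "fst y = c (Suc b)"
    using b by (auto simp: cyc_edge_def doubleton_eq_iff)
  then have "c (Suc b) = c (Suc (Suc (a + j)))"
    using y_snd unfolding c_Suc_eq_iff by simp
  then have "y = cyc_arc (Suc (a + j))"
    using y y_snd by (simp add: cyc_arc_def prod_eq_iff)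
  then show ?case by (simp add: y_def)
qed

text \<open>The product runs over the set of cycle vertices, not over indices, so that both
  orientations of the cycle visibly have the same weight.\<close>

definition cyc_weight :: real where
  "cyc_weight = (\<Prod>v\<in>range c. 2 / real (deg V E v))"

definition cyc_walk :: "nat \<Rightarrow> ('a \<times> 'a) list" where
  "cyc_walk a = map (\<lambda>j. cyc_arc (Suc (a + j))) [0..<k]"

lemma cyc_walk_nth: "j \<le> k \<Longrightarrow> (cyc_arc a # cyc_walk a) ! j = cyc_arc (a + j)"
  by (cases j) (simp_all add: cyc_walk_def)

lemma cyc_arc_arcs: "cyc_arc a \<in> arcs V E"
  by (simp add: cyc_arc_def arcs_def c_V adj_sym c_adj)

lemma swap_arcs: "x \<in> arcs V E \<Longrightarrow> prod.swap x \<in> arcs V E"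
  by (auto simp: arcs_def adj_sym)

lemma cyc_walk_weight: "walk_weight (grover V E) (cyc_arc a) (cyc_walk a) = cyc_weight"
proof -
  \<comment> \<open>The step does not backtrack, so the entry is the one without the summand
    \<open>- 1\<close>.\<close>
  have grov: "grover V E (cyc_arc n) (cyc_arc (Suc n)) = 2 / real (deg V E (c (Suc n)))" for n
    using c_Suc_Suc_neq[of n] by (simp add: grover_def cyc_arc_def)
  have "walk_weight (grover V E) (cyc_arc a) (cyc_walk a) =
      (\<Prod>j<k. 2 / real (deg V E (c (Suc a + j))))"
    unfolding walk_weight_eq_prod
  proof (rule prod.cong)
    fix j assume "j \<in> {..<k}"
    then show "grover V E ((cyc_arc a # cyc_walk a) ! j) (cyc_walk a ! j) =
        2 / real (deg V E (c (Suc a + j)))"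
      using cyc_walk_nth[of j a] grov[of "a + j"] by (simp add: cyc_walk_def)
  qed (simp add: cyc_walk_def)
  also have "\<dots> = (\<Prod>v\<in>(\<lambda>j. c (Suc a + j)) ` {..<k}. 2 / real (deg V E v))"
  proof (subst prod.reindex)
    show inj: "inj_on (\<lambda>j. c (Suc a + j)) {..<k}"
      using c_inj_on by (simp only: inj_on_def c_add_eq_iff)
  qed (simp add: o_def)
  also have "(\<lambda>j. c (Suc a + j)) ` {..<k} = range c"
  proof (rule card_subset_eq)
    have "inj_on (\<lambda>j. c (Suc a + j)) {..<k}"
      using c_inj_on by (simp only: inj_on_def c_add_eq_iff)
    then show "card ((\<lambda>j. c (Suc a + j)) ` {..<k}) = card (range c)"
      by (simp add: card_image card_range_c)
    show "finite (range c)" by (simp add: range_c)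
  qed auto
  finally show ?thesis by (simp add: cyc_weight_def)
qed

text \<open>By \<open>closed_walk_unique\<close> the sum over walks collapses to the single summand
  of \<open>cyc_walk a\<close>.\<close>

lemma mat_pow_girth_cyc_arc:
  "mat_pow (arcs V E) (grover V E) k (cyc_arc a) (cyc_arc a) = cyc_weight"
proof -
  let ?L = "{xs. set xs \<subseteq> arcs V E \<and> length xs = k}"
  have walk: "cyc_walk a \<in> ?L"
    using cyc_arc_arcs by (auto simp: cyc_walk_def)
  have last: "last (cyc_arc a # cyc_walk a) = cyc_arc a"
  proof -
    have "last (cyc_arc a # cyc_walk a) = cyc_arc (a + k)"
      using cyc_walk_nth[of k a] by (simp add: last_conv_nth cyc_walk_def)
    also have "\<dots> = cyc_arc a"
      using c_add_k[of a] c_add_k[of "Suc a"] by (simp add: cyc_arc_def)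
    finally show ?thesis .
  qed
  have summand: "(if last (cyc_arc a # xs) = cyc_arc a then walk_weight (grover V E) (cyc_arc a) xs else 0)
      = (if xs = cyc_walk a then cyc_weight else 0)" if xs: "xs \<in> ?L" for xs
  proof (cases "xs = cyc_walk a")
    case True
    then show ?thesis using last cyc_walk_weight by simp
  next
    case False
    have "walk_weight (grover V E) (cyc_arc a) xs = 0" if closed: "last (cyc_arc a # xs) = cyc_arc a"
    proof (rule ccontr)
      assume wt: "walk_weight (grover V E) (cyc_arc a) xs \<noteq> 0"
      have "xs ! j = cyc_walk a ! j" if "j < k" for j
        using closed_walk_unique[OF _ _ refl closed wt, of "Suc j"] cyc_walk_nth[of "Suc j" a] xs that
        by simp
      then have "xs = cyc_walk a"
        using xs by (intro nth_equalityI) (auto simp: cyc_walk_def)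
      with False show False ..
    qed
    with False show ?thesis by simp
  qed
  have "mat_pow (arcs V E) (grover V E) k (cyc_arc a) (cyc_arc a) =
      (\<Sum>xs\<in>?L. if xs = cyc_walk a then cyc_weight else 0)"
    unfolding mat_pow_eq_sum_walks[OF finite_arcs] by (rule sum.cong[OF refl summand])
  also have "\<dots> = cyc_weight"
    using walk finite_lists_length_eq[OF finite_arcs, of k] by simp
  finally show ?thesis .
qed

text \<open>Some closed walk has nonzero weight, and \<open>e\<close> is its last arc; by
  \<open>closed_walk_girth\<close> the edge of \<open>e\<close> lies on the cycle.\<close>

lemma mat_pow_girth_nonzero:
  assumes "mat_pow (arcs V E) (grover V E) k e e \<noteq> 0"
  shows "\<exists>a. e = cyc_arc a \<or> e = prod.swap (cyc_arc a)"
proof -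
  obtain xs where "xs \<in> {xs. set xs \<subseteq> arcs V E \<and> length xs = k}"
    and nz: "(if last (e # xs) = e then walk_weight (grover V E) e xs else 0) \<noteq> 0"
    using sum.not_neutral_contains_not_neutral[OF assms[unfolded mat_pow_eq_sum_walks[OF finite_arcs]]]
    by blast
  then have xs: "set xs \<subseteq> arcs V E" "length xs = k" by simp_all
  have closed: "last (e # xs) = e" and wt: "walk_weight (grover V E) e xs \<noteq> 0"
    using nz by presburger+
  have "xs \<noteq> []" using xs(2) k3 by auto
  then have "e \<in> set xs" using closed by (metis last_ConsR last_in_set)
  then have "{fst e, snd e} \<in> set (map (\<lambda>x. {fst x, snd x}) xs)" by auto
  then obtain a where "{fst e, snd e} = cyc_edge a"
    unfolding closed_walk_girth(1)[OF xs closed wt] by blast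
  then have "e = cyc_arc a \<or> e = prod.swap (cyc_arc a)"
    by (cases e) (auto simp: cyc_edge_def cyc_arc_def doubleton_eq_iff)
  then show ?thesis by blast
qed

lemma trace_odd_less_girth:
  assumes "odd d" "d < k"
  shows "(\<Sum>e\<in>arcs V E. mat_pow (arcs V E) (grover V E) d e e) = 0"
proof (rule sum.neutral, rule ballI)
  fix e assume "e \<in> arcs V E"
  show "mat_pow (arcs V E) (grover V E) d e e = 0"
    unfolding mat_pow_eq_sum_walks[OF finite_arcs]
    using closed_walk_cyc_edges(2)[of _ e] assms by (intro sum.neutral) force
qed

text \<open>Modulo \<open>k\<close> the factor \<open>k - 1\<close> is \<open>- 1\<close>, which
  reverses the cycle while indices stay natural numbers; facts about one orientation thus transfer
  to the other.\<close>

lemma reversed_unicycle: "unicycle V E k (\<lambda>n. c (n * (k - 1)))"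
proof unfold_locales
  fix a b
  have "Suc (Suc a * (k - 1)) = a * (k - 1) + k"
    using k3 by (cases k) auto
  then have "c (a * (k - 1)) = c (Suc (Suc a * (k - 1)))"
    by (simp only: c_add_k)
  then show "E (c (a * (k - 1))) (c (Suc a * (k - 1)))"
    using adj_sym[OF c_adj[of "Suc a * (k - 1)"]] by simp
  have "coprime (k - 1) k"
    using k3 by (metis coprime_Suc_right_nat coprime_commute Suc_diff_1 less_le_trans zero_less_numeral)
  then show "c (a * (k - 1)) = c (b * (k - 1)) \<longleftrightarrow> a mod k = b mod k"
    using cong_mult_rcancel_nat[of "k - 1" k a b] by (simp add: c_eq_iff cong_def)
qed (use unicycle k3 odd_k in auto)

lemma mat_pow_girth_swap_cyc_arc:
  "mat_pow (arcs V E) (grover V E) k (prod.swap (cyc_arc a)) (prod.swap (cyc_arc a)) = cyc_weight"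
proof -
  define c' where "c' = (\<lambda>n. c (n * (k - 1)))"
  interpret rev: unicycle V E k c'
    unfolding c'_def by (rule reversed_unicycle)
  have "range c' = range c"
  proof (rule card_subset_eq)
    show "finite (range c)" by (simp add: range_c)
    show "card (range c') = card (range c)" by (simp only: rev.card_range_c card_range_c)
  qed (auto simp: c'_def)
  then have weight: "rev.cyc_weight = cyc_weight"
    by (simp add: rev.cyc_weight_def cyc_weight_def)
  define q where "q = k - 2"
  have q: "k = Suc (Suc q)" using k3 by (simp add: q_def)
  \<comment> \<open>\<open>b\<close> is \<open>- (a + 1)\<close> modulo \<open>k\<close>, and a
    second factor \<open>k - 1\<close> turns it back into \<open>a + 1\<close>.\<close>
  define b where "b = Suc a * (k - 1)"
  have "b * (k - 1) = Suc a + (Suc a * q) * k" and "Suc b * (k - 1) = a + (Suc a * q + 1) * k"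
    unfolding b_def q by (simp_all add: algebra_simps)
  then have cb: "c' b = c (Suc a)" "c' (Suc b) = c a"
    by (simp_all only: c'_def c_eq_iff mod_mult_self1)
  have "prod.swap (cyc_arc a) = rev.cyc_arc b"
    by (simp add: cyc_arc_def rev.cyc_arc_def cb)
  then show ?thesis using rev.mat_pow_girth_cyc_arc[of b] weight by simp
qed

lemma card_cycle_arcs: "card (range cyc_arc \<union> prod.swap ` range cyc_arc) = 2 * k"
proof -
  have eq: "cyc_arc a = cyc_arc b \<longleftrightarrow> c a = c b" for a b
    using c_Suc_eq_iff[of a b] by (auto simp: cyc_arc_def)
  have range: "range cyc_arc = cyc_arc ` {..<k}"
  proof -
    have "cyc_arc a \<in> cyc_arc ` {..<k}" for a
      using k3 by (intro image_eqI[of _ _ "a mod k"]) (auto simp: eq c_mod)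
    then show ?thesis by auto
  qed
  have card: "card (range cyc_arc) = k"
    unfolding range by (simp add: card_image inj_on_def eq c_eq_iff)
  have swap: "card (prod.swap ` range cyc_arc) = k"
    by (simp add: card_image card)
  have disj: "range cyc_arc \<inter> prod.swap ` range cyc_arc = {}"
  proof -
    have "cyc_arc a \<noteq> prod.swap (cyc_arc b)" for a b
      using c_Suc_eq_iff[of "Suc a" b] c_Suc_Suc_neq[of a] by (auto simp: cyc_arc_def)
    then show ?thesis by blast
  qed
  have fin: "finite (range cyc_arc)" unfolding range by simp
  show ?thesis
    using card_Un_disjoint[OF fin finite_imageI[OF fin] disj] card swap by simp
qed

lemma trace_girth:
  "(\<Sum>e\<in>arcs V E. mat_pow (arcs V E) (grover V E) k e e) = 2 * k * cyc_weight"
proof -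
  let ?C = "range cyc_arc \<union> prod.swap ` range cyc_arc"
  have "?C \<subseteq> arcs V E"
    using cyc_arc_arcs swap_arcs by blast
  then have "(\<Sum>e\<in>arcs V E. mat_pow (arcs V E) (grover V E) k e e) =
      (\<Sum>e\<in>?C. mat_pow (arcs V E) (grover V E) k e e)"
    using mat_pow_girth_nonzero finite_arcs by (intro sum.mono_neutral_right) blast+
  also have "\<dots> = (\<Sum>e\<in>?C. cyc_weight)"
    using mat_pow_girth_cyc_arc mat_pow_girth_swap_cyc_arc by (intro sum.cong) auto
  finally show ?thesis by (simp add: card_cycle_arcs)
qed

lemma deg_cycle_ge_2: "deg V E (c a) \<ge> 2"
proof -
  \<comment> \<open>Index \<open>a + q\<close> stands for \<open>a - 1\<close> modulo
    \<open>k\<close>, which avoids subtraction at \<open>a = 0\<close>.\<close>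
  obtain q where q: "k = Suc q" using k3 by (cases k) auto
  have prev: "c (Suc (a + q)) = c a" using c_add_k[of a] q by simp
  have "c (a + q) \<noteq> c (Suc a)"
    using c_Suc_Suc_neq[of a] c_Suc_eq_iff[of "a + q" "Suc a"] prev by simp
  moreover have "{c (a + q), c (Suc a)} \<subseteq> {w \<in> V. E (c a) w}"
    using c_adj[of "a + q"] c_adj[of a] prev adj_sym c_V by auto
  ultimately show ?thesis
    unfolding deg_def using card_mono[of "{w \<in> V. E (c a) w}" "{c (a + q), c (Suc a)}"] finite_V
    by simp
qed

text \<open>Dividing the trace \<open>2 * k * cyc_weight\<close> by \<open>k\<close> leaves the
  integer.\<close>

lemma periodic_cyc_weight:
  assumes "grover_periodic V E"
  shows "2 * cyc_weight \<in> \<int>"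
proof -
  obtain m where m: "m > 0"
    "\<forall>e\<in>arcs V E. \<forall>f\<in>arcs V E. mat_pow (arcs V E) (grover V E) m e f = mat_id e f"
    using assms unfolding grover_periodic_def by blast
  have "cyc_weight \<in> \<rat>"
    unfolding cyc_weight_def by (intro Rats_prod) auto
  then have "(\<Sum>e\<in>arcs V E. mat_pow (arcs V E) (grover V E) k e e) \<in> \<rat>"
    unfolding trace_girth by (intro Rats_mult) auto
  from periodic_odd_trace_divisible[OF finite_arcs m odd_k trace_odd_less_girth this]
  show ?thesis using k3 by (simp add: trace_girth)
qed

end

section \<open>Degrees on the cycle\<close>

text \<open>The product exceeds \<open>2 ^ k\<close> by a factor of at most 2. Two factors of at
  least 3 would already give 9/4, so at most one differs from 2; that one divides 4.\<close>

lemma prod_ge_2_dvd_power_2: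
  fixes f :: "nat \<Rightarrow> nat"
  assumes ge2: "\<forall>i<k. f i \<ge> 2" and z: "z * (\<Prod>i<k. f i) = 2 ^ Suc k"
  shows "(\<forall>i<k. f i = 2) \<or> (\<exists>i<k. f i = 4 \<and> (\<forall>l<k. l \<noteq> i \<longrightarrow> f l = 2))"
proof (cases "\<forall>i<k. f i = 2")
  case False
  then obtain i where i: "i < k" "f i \<ge> 3" using ge2 by (metis Suc_1 Suc_leI eval_nat_numeral(3) le_neq_implies_less)
  have lower: "2 ^ card I \<le> prod f I" if "I \<subseteq> {..<k}" for I
    using prod_mono[of I "\<lambda>_. 2" f] that ge2 by auto
  have "z > 0" using z by (cases z) auto
  have prod_i: "(\<Prod>i<k. f i) = f i * prod f ({..<k} - {i})"
    using i by (simp add: prod.remove)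
  have others: "f l = 2" if l: "l < k" "l \<noteq> i" for l
  proof (rule ccontr)
    assume "f l \<noteq> 2"
    then have fl: "f l \<ge> 3" using ge2 l by (metis Suc_1 Suc_leI eval_nat_numeral(3) le_neq_implies_less)
    have "prod f ({..<k} - {i}) = f l * prod f ({..<k} - {i} - {l})"
      using l by (intro prod.remove) auto
    moreover have "card ({..<k} - {i} - {l}) = k - 2"
      using i l by (simp add: card_Diff_singleton)
    then have "2 ^ (k - 2) \<le> prod f ({..<k} - {i} - {l})"
      using lower[of "{..<k} - {i} - {l}"] by auto
    ultimately have "3 * (3 * 2 ^ (k - 2)) \<le> (\<Prod>i<k. f i)"
      unfolding prod_i using i fl by (metis mult_le_mono)
    also have "\<dots> \<le> 2 ^ Suc k" using z \<open>z > 0\<close> by (cases z) auto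
    also have "\<dots> = 8 * 2 ^ (k - 2)"
    proof -
      have "Suc k = 3 + (k - 2)" using i l by arith
      then show ?thesis by (simp only: power_add) simp
    qed
    finally show False by simp
  qed
  then have "prod f ({..<k} - {i}) = 2 ^ (k - 1)"
    using i by (simp add: prod.cong[of "{..<k} - {i}" _ f "\<lambda>_. 2"])
  moreover have "(2::nat) ^ Suc k = 4 * 2 ^ (k - 1)" using i by (cases k) auto
  ultimately have "z * f i = 4" using z prod_i by simp
  then have "f i dvd 4" by (metis dvd_triv_right)
  then have "f i \<le> 4" by (rule dvd_imp_le) simp
  with \<open>f i dvd 4\<close> have "f i = 4" using i by (cases "f i = 3") auto
  then show ?thesis using i others by blast
qed simp

theorem theorem3p2:
  fixes V :: "'a set" and E :: "'a \<Rightarrow> 'a \<Rightarrow> bool" and k :: nat and u :: "nat \<Rightarrow> 'a"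
  assumes "odd_unicycle V E"
    and "k \<ge> 3" and "odd k"
    and "inj_on u {..<k}"
    and "\<forall>i<k. u i \<in> V"
    and "\<forall>i<k. E (u i) (u ((i + 1) mod k))"
    and "grover_periodic V E"
  shows "(\<forall>i<k. deg V E (u i) = 2) \<or>
         (\<exists>i<k. deg V E (u i) = 4 \<and> (\<forall>l<k. l \<noteq> i \<longrightarrow> deg V E (u l) = 2))"
proof -
  define c where "c = (\<lambda>n. u (n mod k))"
  have u_c: "u i = c i" if "i < k" for i using that by (simp add: c_def)
  interpret unicycle V E k c
  proof
    fix a b
    show "c a = c b \<longleftrightarrow> a mod k = b mod k"
      using assms(2,4) by (auto simp: c_def inj_on_def)
    show "E (c a) (c (Suc a))"
      using assms(2,6) by (auto simp: c_def mod_Suc_eq dest: spec[of _ "a mod k"])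
  qed (use assms in auto)
  define D where "D = (\<Prod>i<k. deg V E (u i))"
  have ge2: "\<forall>i<k. deg V E (u i) \<ge> 2"
    using deg_cycle_ge_2 by (simp add: u_c)
  then have "D > 0" unfolding D_def by (intro prod_pos) fastforce
  have "cyc_weight = (\<Prod>i<k. 2 / real (deg V E (u i)))"
    unfolding cyc_weight_def range_c by (subst prod.reindex[OF c_inj_on]) (simp add: u_c)
  \<comment> \<open>The numerators give \<open>2 ^ k\<close>, and the leading 2 raises the exponent
    to \<open>Suc k\<close>.\<close>
  then have weight: "2 * cyc_weight = 2 ^ Suc k / real D"
    by (simp add: prod_dividef D_def)
  obtain z where z: "2 * cyc_weight = of_int z"
    using periodic_cyc_weight[OF assms(7)] by (auto elim: Ints_cases)
  have "z > 0"
    using weight z \<open>D > 0\<close> by (metis divide_pos_pos of_int_0_less_iff of_nat_0_less_iff zero_less_numeral zero_less_power)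
  moreover have "of_int z * real D = 2 ^ Suc k"
    using weight z \<open>D > 0\<close> by (simp add: field_simps)
  ultimately have "real (nat z * D) = real (2 ^ Suc k)" by simp
  then have "nat z * D = 2 ^ Suc k" by (simp only: of_nat_eq_iff)
  then show ?thesis
    using prod_ge_2_dvd_power_2[OF ge2] unfolding D_def by blast
qed

end
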